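(* Let $n\ge 3$ be an integer. Let $q$ be a positive integer and $w_{\max},a_{\max}\in(0,\infty)$ be constants. Consider a growing network described by directed weighted graphs $\mathcal{G}=\mathcal{G}_N$ with $N$ nodes, one for each network size $N$ in an infinite set of positive integers (each $N\ge 2$). Suppose that each graph has a connected spanning tree, has a weighted Laplacian $L=L_N$ that is normal ($L^TL=LL^T$), and satisfies: (1) $|\mathcal{N}_i|\le q$ for every node $i$; (2) $w_{ij}\le w_{\max}$ for every edge $(i,j)$; where $q$ and $w_{\max}$ do not depend on $N$. Suppose that $\mathrm{Re}\{\lambda_2(L_N)\}\to 0$ as $N\to\infty$. Then for no choice of fixed gains $a_0,\dots,a_{n-1}\in[0,a_{\max}]$, independent of $N$, is the $n$-th order consensus control $$u_i=-\sum_{k=0}^{n-1}a_k\sum_{j\in\mathcal{N}_i}w_{ij}\bigl(x_i^{(k)}-x_j^{(k)}\bigr)$$ admissible. That is, for every such choice of gains there is a finite network size $N$ for which the closed-loop system does not reach consensus.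
   Context: Graphs: $\mathcal{G}=\{\mathcal{V},\mathcal{E}\}$ has $N=|\mathcal{V}|$ nodes and edge set $\mathcal{E}\subset\mathcal{V}\times\mathcal{V}$ (no self-loops). Each edge $(i,j)$ has a nonnegative weight $w_{ij}$, and $w_{ij}=0$ if $(i,j)\notin\mathcal{E}$. The neighbor set is $\mathcal{N}_i=\{j:(i,j)\in\mathcal{E}\}$. The graph has a connected spanning tree if there is a path from some node $i$ to every other node. Laplacian: $[L]_{ij}=-w_{ij}$ if $j\ne i$ and $j\in\mathcal{N}_i$, $[L]_{ii}=\sum_{k\in\mathcal{N}_i}w_{ik}$, and $[L]_{ij}=0$ otherwise. By the standing assumption that there is a connected spanning tree, $0$ is a simple eigenvalue of $L$ and the remaining eigenvalues have positive real parts. The eigenvalues are numbered so that $0=\lambda_1<\mathrm{Re}\{\lambda_2\}\le\dots\le\mathrm{Re}\{\lambda_N\}$. Dynamics: each node $i$ has a scalar state $x_i(t)\in\mathbb{R}$, and $x_i^{(k)}$ is its $k$-th time derivative. The local dynamics are the chain of $n$ integrators $\frac{d}{dt}x_i^{(k)}=x_i^{(k+1)}$ for $k=0,\dots,n-2$, and $\frac{d}{dt}x_i^{(n-1)}=u_i$. With the control given in the claim, the closed loop is $x^{(n)}=-\sum_{k=0}^{n-1}a_kLx^{(k)}$ for $x=(x_1,\dots,x_N)^T$. Consensus is reached if, for every initial condition, $x_i^{(k)}(t)-x_j^{(k)}(t)\to 0$ as $t\to\infty$ for all nodes $i,j$ and all $k=0,1,\dots,n-1$. Admissibility: a control design is admissible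 only if the resulting closed-loop system reaches consensus for any finite network size $N$ (in the growing network under consideration). An increase in the network size means the addition of nodes together with connecting edges in such a manner that the assumptions in the claim remain satisfied, with the gains, $q$ and $w_{\max}$ unchanged. *)

theory Defs
  imports
    Complex_Main
    "HOL-Computational_Algebra.Computational_Algebra"
    "Jordan_Normal_Form.Char_Poly"
begin

text \<open>
  The nodes of a network are the numbers \<open>0, \<dots>, N - 1\<close>, so that they index the rows and columns of
  an \<open>N\<close>-by-\<open>N\<close> matrix. An edge \<open>(i, j)\<close> means that node \<open>i\<close> uses the state of node \<open>j\<close>.
\<close>

record network =
  num_nodes :: nat
  edges :: "(nat \<times> nat) set"
  weight :: "nat \<Rightarrow> nat \<Rightarrow> real"

definition weighted_digraph :: "network \<Rightarrow> bool" where
  "weighted_digraph G \<longleftrightarrow>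
     edges G \<subseteq> {..<num_nodes G} \<times> {..<num_nodes G} \<and>
     (\<forall>i. (i, i) \<notin> edges G) \<and>
     (\<forall>i j. weight G i j \<ge> 0) \<and>
     (\<forall>i j. (i, j) \<notin> edges G \<longrightarrow> weight G i j = 0)"

definition neighbors :: "network \<Rightarrow> nat \<Rightarrow> nat set" where
  "neighbors G i = {j. (i, j) \<in> edges G}"

definition has_spanning_tree :: "network \<Rightarrow> bool" where
  "has_spanning_tree G \<longleftrightarrow>
     (\<exists>r<num_nodes G. \<forall>j<num_nodes G. (r, j) \<in> (edges G)\<^sup>*)"

definition laplacian :: "network \<Rightarrow> real mat" where
  "laplacian G = mat (num_nodes G) (num_nodes G) (\<lambda>(i, j).
     if j \<noteq> i \<and> j \<in> neighbors G i then - weight G i j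
     else if j = i then (\<Sum>k\<in>neighbors G i. weight G i k)
     else 0)"

definition normal_matrix :: "real mat \<Rightarrow> bool" where
  "normal_matrix A \<longleftrightarrow> transpose_mat A * A = A * transpose_mat A"

text \<open>
  The real parts of the complex eigenvalues of a real square matrix, repeated according to algebraic
  multiplicity and in ascending order. The list counts from \<open>0\<close>, so the \<open>k\<close>-th eigenvalue in the
  usual numbering \<open>\<lambda>\<^sub>1, \<lambda>\<^sub>2, \<dots>\<close> by real part has its real part at position \<open>k - 1\<close>.
\<close>

definition eigenvalue_real_parts :: "real mat \<Rightarrow> real list" where
  "eigenvalue_real_parts A =
     sorted_list_of_multiset (image_mset Re (proots (char_poly (map_mat complex_of_real A))))"

definition Re_lambda2 :: "network \<Rightarrow> real" where
  "Re_lambda2 G = eigenvalue_real_parts (laplacian G) ! 1"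

definition consensus_control ::
    "network \<Rightarrow> nat \<Rightarrow> (nat \<Rightarrow> real) \<Rightarrow> (nat \<Rightarrow> nat \<Rightarrow> real) \<Rightarrow> nat \<Rightarrow> real" where
  "consensus_control G n a x i =
     - (\<Sum>k<n. a k * (\<Sum>j\<in>neighbors G i. weight G i j * (x k i - x k j)))"

text \<open>
  \<open>x k i t\<close> is the \<open>k\<close>-th time derivative of the state of node \<open>i\<close> at time \<open>t \<ge> 0\<close>.
\<close>

definition closed_loop_trajectory ::
    "network \<Rightarrow> nat \<Rightarrow> (nat \<Rightarrow> real) \<Rightarrow> (nat \<Rightarrow> nat \<Rightarrow> real \<Rightarrow> real) \<Rightarrow> bool" where
  "closed_loop_trajectory G n a x \<longleftrightarrow>
     (\<forall>i<num_nodes G. \<forall>t\<ge>0.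
        (\<forall>k<n - 1. (x k i has_real_derivative x (Suc k) i t) (at t within {0..})) \<and>
        (x (n - 1) i has_real_derivative consensus_control G n a (\<lambda>k j. x k j t) i)
          (at t within {0..}))"

text \<open>
  Quantifying over all trajectories amounts to quantifying over all initial conditions, since the
  closed loop is a linear system with constant coefficients and hence has exactly one trajectory
  for each initial condition.
\<close>

definition reaches_consensus :: "network \<Rightarrow> nat \<Rightarrow> (nat \<Rightarrow> real) \<Rightarrow> bool" where
  "reaches_consensus G n a \<longleftrightarrow>
     (\<forall>x. closed_loop_trajectory G n a x \<longrightarrow>
        (\<forall>i<num_nodes G. \<forall>j<num_nodes G. \<forall>k<n. ((\<lambda>t. x k i t - x k j t) \<longlongrightarrow> 0) at_top))"

definition admissible :: "nat set \<Rightarrow> (nat \<Rightarrow> network) \<Rightarrow> nat \<Rightarrow> (nat \<Rightarrow> real) \<Rightarrow> bool" where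
  "admissible sizes G n a \<longleftrightarrow> (\<forall>N\<in>sizes. reaches_consensus (G N) n a)"

end

theory Submission
  imports Defs "Jordan_Normal_Form.Schur_Decomposition"
begin

text \<open>
  On an eigenvector \<open>v\<close> of the Laplacian with eigenvalue \<open>\<lambda>\<close>, the closed loop has the modes
  \<open>x(t) = e\<^bsup>st\<^esup> v\<close>, where \<open>s\<close> is a root of
  \<open>s\<^sup>n + \<lambda> (a\<^sub>0 + a\<^sub>1 s + \<dots> + a\<^bsub>n-1\<^esub> s\<^bsup>n-1\<^esup>)\<close>. If \<open>v\<close> has two different entries and \<open>Re s \<ge> 0\<close>, the
  disagreement between the corresponding nodes does not decay, so consensus fails
  (\<open>unstable_mode_prevents_consensus\<close>). It remains to find such a root for a large network.

  The eigenvalue \<open>\<lambda>\<close> is \<open>\<lambda>\<^sub>2\<close>. By Gershgorin's theorem it lies in a disc that touches the imaginary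
  axis at \<open>0\<close> and whose radius is at most \<open>q w\<^sub>m\<^sub>a\<^sub>x\<close>, whence \<open>|\<lambda>|\<^sup>2 \<le> 2 q w\<^sub>m\<^sub>a\<^sub>x Re \<lambda>\<close>
  (\<open>gershgorin_disc_at_origin\<close>). Since the radius is bounded, \<open>Re \<lambda>\<^sub>2 \<longlongrightarrow> 0\<close> forces \<open>\<lambda>\<^sub>2 \<longlongrightarrow> 0\<close>.

  For small \<open>\<lambda>\<close> the polynomial has a root in the closed right half-plane
  (\<open>closed_right_half_plane_root\<close>). Suppose instead that all roots \<open>s\<^sub>i\<close> have negative real part, so
  that \<open>\<lambda> a\<^sub>0 \<noteq> 0\<close>, and put \<open>r\<^sub>i = 1 / s\<^sub>i\<close>. Dividing the polynomial by \<open>\<lambda> a\<^sub>0\<close> removes \<open>\<lambda>\<close> from all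
  coefficients below degree \<open>n\<close>. As \<open>n \<ge> 3\<close>, this covers the degrees \<open>1\<close> and \<open>2\<close>, and Newton's
  identities give \<open>\<Sum> r\<^sub>i = - a\<^sub>1 / a\<^sub>0\<close> and \<open>\<Sum> r\<^sub>i\<^sup>2 = (a\<^sub>1 / a\<^sub>0)\<^sup>2 - 2 a\<^sub>2 / a\<^sub>0\<close>. The numbers \<open>- Re r\<^sub>i\<close> are
  positive and have the sum \<open>a\<^sub>1 / a\<^sub>0\<close>, so \<open>\<Sum> (Re r\<^sub>i)\<^sup>2 \<le> (a\<^sub>1 / a\<^sub>0)\<^sup>2\<close>, and the second identity then bounds
  \<open>\<Sum> (Im r\<^sub>i)\<^sup>2\<close>. Altogether \<open>|r\<^sub>i|\<^sup>2 \<le> (a\<^sub>1 / a\<^sub>0)\<^sup>2 + 2 a\<^sub>2 / a\<^sub>0\<close> independently of \<open>\<lambda>\<close>, whereas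
  \<open>\<Prod> |r\<^sub>i| = 1 / |\<lambda> a\<^sub>0|\<close> is unbounded as \<open>\<lambda> \<longlongrightarrow> 0\<close>.

  Edges may have weight \<open>0\<close>, so \<open>\<lambda>\<^sub>2 = 0\<close> is possible. Then an eigenvector with two different entries
  exists because \<open>0\<close> is a multiple eigenvalue and the columns of a normal Laplacian sum to \<open>0\<close>, which
  excludes a Jordan chain that ends in a constant vector (\<open>disagreement_eigenvector\<close>).
\<close>

section \<open>Roots of the characteristic polynomial of a mode\<close>

text \<open>
  Newton's identities for the first two power sums, read off from \<open>\<Prod> (1 - r\<^sub>i X)\<close>.
\<close>

lemma coeff_prod_list_one_minus:
  fixes rs :: "complex list"
  defines "P \<equiv> (\<Prod>r\<leftarrow>rs. [:1, - r:])"
  shows "coeff P 0 = 1" and "coeff P 1 = - sum_list rs"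
    and "2 * coeff P 2 = (sum_list rs)\<^sup>2 - (\<Sum>r\<leftarrow>rs. r\<^sup>2)"
proof -
  have "coeff P 0 = 1 \<and> coeff P 1 = - sum_list rs \<and>
      2 * coeff P 2 = (sum_list rs)\<^sup>2 - (\<Sum>r\<leftarrow>rs. r\<^sup>2)"
    unfolding P_def
    by (induction rs) (auto simp: coeff_pCons numeral_2_eq_2 algebra_simps power2_eq_square)
  then show "coeff P 0 = 1" and "coeff P 1 = - sum_list rs"
    and "2 * coeff P 2 = (sum_list rs)\<^sup>2 - (\<Sum>r\<leftarrow>rs. r\<^sup>2)" by auto
qed

lemma prod_list_linear_factors_reciprocal:
  fixes ss :: "'a::field list"
  assumes "0 \<notin> set ss"
  shows "(\<Prod>s\<leftarrow>ss. [:- s, 1:]) =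
    Polynomial.smult (\<Prod>s\<leftarrow>ss. - s) (\<Prod>r\<leftarrow>map inverse ss. [:1, - r:])"
  using assms
proof (induction ss)
  case (Cons s ss)
  have "[:- s, 1:] = Polynomial.smult (- s) [:1, - inverse s:]" using Cons.prems by simp
  then show ?case using Cons
    by (simp only: list.map prod_list.Cons set_simps insert_iff de_Morgan_disj
        mult.commute[of _ "- s"] mult_smult_left mult_smult_right smult_smult simp_thms)
qed simp

lemma sum_list_squares_le_square_sum_list:
  fixes xs :: "real list"
  assumes "\<forall>x\<in>set xs. 0 \<le> x"
  shows "(\<Sum>x\<leftarrow>xs. x\<^sup>2) \<le> (sum_list xs)\<^sup>2"
  using assms
proof (induction xs)
  case (Cons x xs)
  then have "0 \<le> x * sum_list xs" by (intro mult_nonneg_nonneg sum_list_nonneg) auto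
  with Cons show ?case by (auto simp: power2_sum)
qed simp

lemma prod_list_norm_lower_bound:
  fixes ss :: "complex list"
  assumes "\<forall>s\<in>set ss. 1 \<le> K * (cmod s)\<^sup>2"
  shows "1 \<le> K ^ length ss * (cmod (\<Prod>s\<leftarrow>ss. - s))\<^sup>2"
  using assms
proof (induction ss)
  case (Cons s ss)
  have "1 * 1 \<le> (K * (cmod s)\<^sup>2) * (K ^ length ss * (cmod (\<Prod>s\<leftarrow>ss. - s))\<^sup>2)"
    using Cons by (intro mult_mono) auto
  then show ?case by (simp add: norm_mult power_mult_distrib mult_ac)
qed simp

lemma monic_complex_poly_linear_factors:
  fixes p :: "complex poly"
  assumes "lead_coeff p = 1"
  shows "\<exists>ss. p = (\<Prod>s\<leftarrow>ss. [:- s, 1:]) \<and> length ss = degree p"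
proof -
  obtain ss where ss: "mset ss = proots p" using ex_mset by blast
  have "p = (\<Prod>x\<in>#proots p. [:- x, 1:])"
    using complex_poly_decompose_multiset[of p] assms by simp
  also have "\<dots> = (\<Prod>s\<leftarrow>ss. [:- s, 1:])"
    by (simp flip: ss prod_mset_prod_list)
  finally show ?thesis using ss size_proots_complex[of p] by (metis size_mset)
qed

text \<open>
  If \<open>a 0 = 0\<close>, the smallness hypothesis holds trivially, and \<open>s = 0\<close> is a root.
\<close>

lemma closed_right_half_plane_root:
  fixes a :: "nat \<Rightarrow> real" and lam :: complex
  assumes n: "n \<ge> 3"
    and small: "((a 1 / a 0)\<^sup>2 + 2 * (a 2 / a 0)) ^ n * (cmod lam * a 0)\<^sup>2 < 1"
  shows "\<exists>s. Re s \<ge> 0 \<and> s ^ n + lam * (\<Sum>k<n. of_real (a k) * s ^ k) = 0"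
proof (rule ccontr)
  assume contra: "\<not> ?thesis"
  define p where "p = monom 1 n + Polynomial.smult lam (\<Sum>k<n. monom (complex_of_real (a k)) k)"
  have poly_p: "poly p s = s ^ n + lam * (\<Sum>k<n. of_real (a k) * s ^ k)" for s
    by (simp add: p_def poly_monom poly_sum)
  have coeff_p: "coeff p k = (if k = n then 1 else if k < n then lam * of_real (a k) else 0)" for k
    by (auto simp: p_def coeff_sum)
  have "degree p = n"
    by (intro antisym degree_le le_degree) (auto simp: coeff_p)
  then have lead: "lead_coeff p = 1" by (simp add: coeff_p)
  obtain ss where ss: "p = (\<Prod>s\<leftarrow>ss. [:- s, 1:])" "length ss = n"
    using monic_complex_poly_linear_factors[of p] lead \<open>degree p = n\<close> by metis
  have neg: "Re s < 0" if "s \<in> set ss" for s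
  proof -
    have "poly p s = 0" using that by (auto simp: ss(1) poly_prod_list prod_list_zero_iff)
    with contra show ?thesis by (force simp: poly_p)
  qed
  define c where "c = (\<Prod>s\<leftarrow>ss. - s)"
  define rs where "rs = map inverse ss"
  \<comment> \<open>The roots \<open>s\<close> are nonzero, and their reciprocals \<open>r\<close> also have negative real part.\<close>
  have p_rs: "p = Polynomial.smult c (\<Prod>r\<leftarrow>rs. [:1, - r:])"
    unfolding ss(1) c_def rs_def
    by (rule prod_list_linear_factors_reciprocal) (use neg in force)
  have c: "c = lam * of_real (a 0)"
    using coeff_p[of 0] coeff_prod_list_one_minus(1)[of rs] n by (simp add: p_rs)
  have "c \<noteq> 0" using neg by (force simp: c_def prod_list_zero_iff)
  with c have "lam \<noteq> 0" "a 0 \<noteq> 0" by auto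
  have "c * - sum_list rs = lam * of_real (a 1)"
    using coeff_p[of 1] coeff_prod_list_one_minus(2)[of rs] n by (simp add: p_rs)
  then have "of_real (a 1) = of_real (a 0) * (- sum_list rs)"
    using \<open>lam \<noteq> 0\<close> by (simp add: c mult.assoc flip: mult_minus_right)
  then have sum1: "sum_list rs = - of_real (a 1 / a 0)"
    using \<open>a 0 \<noteq> 0\<close> by simp
  have "c * (2 * coeff (\<Prod>r\<leftarrow>rs. [:1, - r:]) 2) = 2 * (lam * of_real (a 2))"
    using coeff_p[of 2] n by (simp add: p_rs)
  then have "c * ((sum_list rs)\<^sup>2 - (\<Sum>r\<leftarrow>rs. r\<^sup>2)) = 2 * (lam * of_real (a 2))"
    by (simp only: coeff_prod_list_one_minus(3))
  then have "lam * (of_real (a 0) * ((sum_list rs)\<^sup>2 - (\<Sum>r\<leftarrow>rs. r\<^sup>2))) =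
      lam * of_real (2 * a 2)"
    by (simp add: c mult_ac)
  then have "of_real (a 0) * ((sum_list rs)\<^sup>2 - (\<Sum>r\<leftarrow>rs. r\<^sup>2)) = of_real (2 * a 2)"
    unfolding mult_cancel_left using \<open>lam \<noteq> 0\<close> by blast
  then have "(sum_list rs)\<^sup>2 - (\<Sum>r\<leftarrow>rs. r\<^sup>2) = of_real (2 * (a 2 / a 0))"
    using \<open>a 0 \<noteq> 0\<close> by (simp add: field_simps)
  then have sum2: "(\<Sum>r\<leftarrow>rs. r\<^sup>2) = of_real ((a 1 / a 0)\<^sup>2 - 2 * (a 2 / a 0))"
    by (simp add: sum1 algebra_simps)
  have "(\<Sum>r\<leftarrow>rs. - Re r) = - Re (sum_list rs)" by (induction rs) auto
  then have re1: "(\<Sum>r\<leftarrow>rs. - Re r) = a 1 / a 0" by (simp add: sum1)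
  define K where "K = (a 1 / a 0)\<^sup>2 + 2 * (a 2 / a 0)"
  have "(\<Sum>r\<leftarrow>rs. (- Re r)\<^sup>2) \<le> (\<Sum>r\<leftarrow>rs. - Re r)\<^sup>2"
    using sum_list_squares_le_square_sum_list[of "map (\<lambda>r. - Re r) rs"] neg
    by (force simp: o_def rs_def Re_complex_div_le_0 inverse_eq_divide)
  then have "(\<Sum>r\<leftarrow>rs. (Re r)\<^sup>2) \<le> (a 1 / a 0)\<^sup>2" by (simp add: re1)
  \<comment> \<open>Termwise \<open>(cmod r)\<^sup>2 = 2 (Re r)\<^sup>2 - Re (r\<^sup>2)\<close>, so the two power sums control all moduli.\<close>
  moreover have "(\<Sum>r\<leftarrow>rs. (cmod r)\<^sup>2) = 2 * (\<Sum>r\<leftarrow>rs. (Re r)\<^sup>2) - Re (\<Sum>r\<leftarrow>rs. r\<^sup>2)"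
    by (induction rs) (auto simp: cmod_power2 Re_power2)
  ultimately have sum_cmod: "(\<Sum>r\<leftarrow>rs. (cmod r)\<^sup>2) \<le> K"
    by (simp add: sum2 K_def)
  have "1 \<le> K * (cmod s)\<^sup>2" if s: "s \<in> set ss" for s
  proof -
    have "(cmod (inverse s))\<^sup>2 \<le> (\<Sum>r\<leftarrow>rs. (cmod r)\<^sup>2)"
      using s by (intro member_le_sum_list) (auto simp: rs_def)
    then have "(inverse (cmod s))\<^sup>2 \<le> K" using sum_cmod by (simp add: norm_inverse)
    moreover have "cmod s > 0" using neg[OF s] by auto
    ultimately show ?thesis by (simp add: field_simps)
  qed
  then have "1 \<le> K ^ n * (cmod c)\<^sup>2"
    using prod_list_norm_lower_bound[of ss K] by (simp add: c_def ss(2))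
  with small show False by (simp add: K_def c norm_mult power_mult_distrib)
qed

section \<open>Spectrum of the Laplacian\<close>

text \<open>
  The Laplacian as a complex matrix, on which its complex eigenvectors are defined.
\<close>

definition complex_laplacian :: "network \<Rightarrow> complex mat" where
  "complex_laplacian G = map_mat complex_of_real (laplacian G)"

lemma complex_laplacian_carrier [simp]:
  "complex_laplacian G \<in> carrier_mat (num_nodes G) (num_nodes G)"
  by (simp add: complex_laplacian_def laplacian_def)

lemma neighbors_are_other_nodes:
  assumes "weighted_digraph G"
  shows "neighbors G i \<subseteq> {..<num_nodes G}" and "i \<notin> neighbors G i"
  using assms by (auto simp: weighted_digraph_def neighbors_def)

lemma complex_laplacian_mult_vec:
  assumes G: "weighted_digraph G" and v: "v \<in> carrier_vec (num_nodes G)" and i: "i < num_nodes G"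
  shows "(complex_laplacian G *\<^sub>v v) $ i =
    (\<Sum>j\<in>neighbors G i. complex_of_real (weight G i j) * (v $ i - v $ j))"
proof -
  let ?N = "num_nodes G" and ?d = "\<Sum>k\<in>neighbors G i. complex_of_real (weight G i k)"
  note nb = neighbors_are_other_nodes[OF G, of i]
  have "(complex_laplacian G *\<^sub>v v) $ i =
      (\<Sum>j<?N. complex_of_real (laplacian G $$ (i, j)) * v $ j)"
    using v i by (simp add: complex_laplacian_def laplacian_def scalar_prod_def lessThan_atLeast0)
  also have "\<dots> = (\<Sum>j\<in>{..<?N}. (if j = i then ?d * v $ j else 0) +
        (if j \<in> neighbors G i then - of_real (weight G i j) * v $ j else 0))"
    using i nb(2) by (intro sum.cong) (auto simp: laplacian_def)
  also have "\<dots> = ?d * v $ i + (\<Sum>j\<in>{..<?N} \<inter> neighbors G i. - of_real (weight G i j) * v $ j)"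
    using i by (simp add: sum.distrib sum.inter_restrict del: mult_minus_left)
  also have "{..<?N} \<inter> neighbors G i = neighbors G i" using nb(1) by auto
  finally show ?thesis
    by (simp add: algebra_simps sum_subtractf sum_distrib_left sum_negf)
qed

text \<open>
  Gershgorin's disc of a row has its centre at the diagonal entry \<open>d\<close>, which is also its radius. The
  condition \<open>|d - \<lambda>| \<le> d\<close> is equivalent to \<open>|\<lambda>|\<^sup>2 \<le> 2 d Re \<lambda>\<close>.
\<close>

lemma gershgorin_disc_at_origin:
  assumes G: "weighted_digraph G"
    and ev: "eigenvalue (complex_laplacian G) lam"
  shows "\<exists>i<num_nodes G. (cmod lam)\<^sup>2 \<le> 2 * (\<Sum>j\<in>neighbors G i. weight G i j) * Re lam"
    and "0 \<le> Re lam"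
proof -
  let ?N = "num_nodes G"
  from ev obtain v where v: "v \<in> carrier_vec ?N" "v \<noteq> 0\<^sub>v ?N"
    and Lv: "complex_laplacian G *\<^sub>v v = lam \<cdot>\<^sub>v v"
    by (auto simp: eigenvalue_def eigenvector_def complex_laplacian_def laplacian_def)
  obtain i0 where i0: "i0 < ?N" "v $ i0 \<noteq> 0" using v by (metis carrier_vecD eq_vecI index_zero_vec)
  \<comment> \<open>A row where the eigenvector has an entry of the largest modulus.\<close>
  have "Max ((\<lambda>j. cmod (v $ j)) ` {..<?N}) \<in> (\<lambda>j. cmod (v $ j)) ` {..<?N}"
    using i0(1) by (intro Max_in) auto
  then obtain i where "i < ?N" "cmod (v $ i) = Max ((\<lambda>j. cmod (v $ j)) ` {..<?N})" by auto
  then have i: "i < ?N" and mx: "\<And>j. j < ?N \<Longrightarrow> cmod (v $ j) \<le> cmod (v $ i)" by auto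
  have vi: "cmod (v $ i) > 0" using i0(2) by (intro less_le_trans[OF _ mx[OF i0(1)]]) simp
  define d where "d = (\<Sum>j\<in>neighbors G i. weight G i j)"
  have w: "weight G i j \<ge> 0" for j using G by (auto simp: weighted_digraph_def)
  have "lam * v $ i = (\<Sum>j\<in>neighbors G i. of_real (weight G i j) * (v $ i - v $ j))"
    using complex_laplacian_mult_vec[OF G v(1) i] Lv v(1) i by simp
  then have "(of_real d - lam) * v $ i = (\<Sum>j\<in>neighbors G i. of_real (weight G i j) * v $ j)"
    by (simp add: d_def algebra_simps sum_subtractf sum_distrib_left)
  then have "cmod (of_real d - lam) * cmod (v $ i) =
      cmod (\<Sum>j\<in>neighbors G i. of_real (weight G i j) * v $ j)"
    by (simp flip: norm_mult)
  also have "\<dots> \<le> (\<Sum>j\<in>neighbors G i. weight G i j * cmod (v $ i))"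
    using neighbors_are_other_nodes(1)[OF G, of i] w mx
    by (intro sum_norm_le) (auto simp: norm_mult intro!: mult_left_mono)
  also have "\<dots> = d * cmod (v $ i)" by (simp add: d_def sum_distrib_right)
  finally have "cmod (of_real d - lam) \<le> d" using vi by simp
  then have "(cmod (of_real d - lam))\<^sup>2 \<le> d\<^sup>2" by (intro power_mono) auto
  then have disc: "(cmod lam)\<^sup>2 \<le> 2 * d * Re lam"
    unfolding cmod_power2 by (simp add: power2_eq_square algebra_simps)
  have d0: "0 \<le> d" using w by (auto simp: d_def intro!: sum_nonneg)
  show "0 \<le> Re lam"
  proof (cases "d = 0")
    case True
    then show ?thesis using disc by simp
  next
    case False
    have "0 \<le> 2 * d * Re lam" using disc by (rule order_trans[OF zero_le_power2])
    with False d0 show ?thesis by (simp add: zero_le_mult_iff)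
  qed
  show "\<exists>i<?N. (cmod lam)\<^sup>2 \<le> 2 * (\<Sum>j\<in>neighbors G i. weight G i j) * Re lam"
    using disc i by (auto simp: d_def)
qed

lemma complex_laplacian_mult_ones:
  assumes "weighted_digraph G"
  shows "complex_laplacian G *\<^sub>v vec (num_nodes G) (\<lambda>_. 1) = 0\<^sub>v (num_nodes G)"
proof (rule eq_vecI)
  fix i assume "i < dim_vec (0\<^sub>v (num_nodes G))"
  then have i: "i < num_nodes G" by simp
  show "(complex_laplacian G *\<^sub>v vec (num_nodes G) (\<lambda>_. 1)) $ i = 0\<^sub>v (num_nodes G) $ i"
    unfolding complex_laplacian_mult_vec[OF assms vec_carrier i]
    using neighbors_are_other_nodes(1)[OF assms, of i] i by (auto intro!: sum.neutral)
qed (simp add: complex_laplacian_def laplacian_def)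

lemma laplacian_row_sum:
  assumes "weighted_digraph G" "i < num_nodes G"
  shows "(\<Sum>j<num_nodes G. laplacian G $$ (i, j)) = 0"
proof -
  let ?N = "num_nodes G"
  have "complex_of_real (\<Sum>j<?N. laplacian G $$ (i, j)) =
      (complex_laplacian G *\<^sub>v vec ?N (\<lambda>_. 1)) $ i"
    using assms(2)
    by (simp add: complex_laplacian_def laplacian_def scalar_prod_def lessThan_atLeast0)
  also have "\<dots> = 0" using assms by (simp only: complex_laplacian_mult_ones index_zero_vec)
  finally show ?thesis by (simp only: of_real_eq_0_iff)
qed

text \<open>
  With \<open>\<one>\<close> the vector of ones, \<open>|L\<^sup>T \<one>|\<^sup>2 = \<one>\<^sup>T L L\<^sup>T \<one> = \<one>\<^sup>T L\<^sup>T L \<one> = 0\<close>, as \<open>L \<one> = 0\<close>.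
\<close>

lemma normal_laplacian_column_sum:
  assumes G: "weighted_digraph G" and normal: "normal_matrix (laplacian G)"
    and j: "j < num_nodes G"
  shows "(\<Sum>i<num_nodes G. laplacian G $$ (i, j)) = 0"
proof -
  let ?N = "num_nodes G"
  define L where "L = laplacian G"
  have L: "L \<in> carrier_mat ?N ?N" by (simp add: L_def laplacian_def)
  have comm: "(\<Sum>k<?N. L $$ (k, i) * L $$ (k, j)) = (\<Sum>k<?N. L $$ (i, k) * L $$ (j, k))"
    if "i < ?N" "j < ?N" for i j
  proof -
    have "(transpose_mat L * L) $$ (i, j) = (L * transpose_mat L) $$ (i, j)"
      using normal by (simp add: normal_matrix_def L_def)
    with that L show ?thesis by (simp add: scalar_prod_def lessThan_atLeast0)
  qed
  have "(\<Sum>k<?N. (\<Sum>i<?N. L $$ (i, k))\<^sup>2) =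
      (\<Sum>k<?N. \<Sum>i<?N. \<Sum>j<?N. L $$ (i, k) * L $$ (j, k))"
    by (simp add: power2_eq_square sum_product)
  also have "\<dots> = (\<Sum>i<?N. \<Sum>k<?N. \<Sum>j<?N. L $$ (i, k) * L $$ (j, k))" by (rule sum.swap)
  also have "\<dots> = (\<Sum>i<?N. \<Sum>j<?N. \<Sum>k<?N. L $$ (i, k) * L $$ (j, k))"
    by (intro sum.cong refl sum.swap)
  also have "\<dots> = (\<Sum>i<?N. \<Sum>j<?N. \<Sum>k<?N. L $$ (k, i) * L $$ (k, j))"
    by (simp add: comm)
  also have "\<dots> = (\<Sum>i<?N. \<Sum>k<?N. L $$ (k, i) * (\<Sum>j<?N. L $$ (k, j)))"
    by (simp only: sum_distrib_left) (intro sum.cong refl sum.swap)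
  also have "\<dots> = 0" using laplacian_row_sum[OF G] by (simp add: L_def)
  finally have "\<forall>k\<in>{..<?N}. (\<Sum>i<?N. L $$ (i, k))\<^sup>2 = 0"
    by (subst (asm) sum_nonneg_eq_0_iff) auto
  with j show ?thesis by (simp add: L_def)
qed

lemma eigenvalue_0_complex_laplacian:
  assumes "weighted_digraph G" "num_nodes G > 0"
  shows "eigenvalue (complex_laplacian G) 0"
proof -
  let ?N = "num_nodes G" and ?u = "vec (num_nodes G) (\<lambda>_. 1 :: complex)"
  have "complex_laplacian G *\<^sub>v ?u = 0 \<cdot>\<^sub>v ?u"
    unfolding complex_laplacian_mult_ones[OF assms(1)] by auto
  moreover have "?u \<noteq> 0\<^sub>v ?N" using assms(2) by (auto simp: vec_eq_iff)
  ultimately have "eigenvector (complex_laplacian G) ?u 0"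
    by (auto simp: eigenvector_def complex_laplacian_def laplacian_def)
  then show ?thesis by (auto simp: eigenvalue_def)
qed

text \<open>
  All eigenvalues have nonnegative real part, so the eigenvalue \<open>0\<close> may be taken as the first in the
  order by real part. The next one has real part \<open>Re_lambda2 G\<close>.
\<close>

lemma char_poly_laplacian_factors:
  assumes G: "weighted_digraph G" and N: "num_nodes G \<ge> 2"
  obtains lam es where "char_poly (complex_laplacian G) = (\<Prod>e\<leftarrow>0 # lam # es. [:- e, 1:])"
    and "Re lam = Re_lambda2 G"
proof -
  let ?A = "complex_laplacian G" and ?N = "num_nodes G"
  define p where "p = char_poly ?A"
  have p: "degree p = ?N" "lead_coeff p = 1"
    using degree_monic_char_poly[OF complex_laplacian_carrier, of G] by (auto simp: p_def)
  then have "p \<noteq> 0" by auto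
  define M where "M = proots p"
  have in_M: "z \<in># M \<longleftrightarrow> eigenvalue ?A z" for z
    using \<open>p \<noteq> 0\<close> by (simp add: M_def p_def eigenvalue_root_char_poly[OF complex_laplacian_carrier])
  have "0 \<in># M" using eigenvalue_0_complex_laplacian[OF G] N by (simp add: in_M)
  then obtain M1 where M1: "M = add_mset 0 M1" by (metis multi_member_split)
  have "size M = ?N" by (simp add: M_def size_proots_complex p)
  with M1 N have "M1 \<noteq> {#}" by auto
  have nonneg: "0 \<le> Re z" if "z \<in># M" for z
    using gershgorin_disc_at_origin(2)[OF G] that in_M by auto
  obtain y ys where ys: "sorted_list_of_multiset (image_mset Re M1) = y # ys"
    using \<open>M1 \<noteq> {#}\<close> by (cases "sorted_list_of_multiset (image_mset Re M1)")
      (auto dest: arg_cong[of _ _ mset])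
  have "set (y # ys) = Re ` set_mset M1"
    unfolding ys[symmetric] by simp
  then obtain lam where lam: "lam \<in># M1" "Re lam = y" by (metis imageE list.set_intros(1))
  have "0 \<le> y" using nonneg[of lam] lam by (simp add: M1)
  then have "Re_lambda2 G = y"
    by (simp add: Re_lambda2_def eigenvalue_real_parts_def M1 ys
        flip: complex_laplacian_def p_def M_def)
  from lam obtain M2 where M2: "M1 = add_mset lam M2" by (metis multi_member_split)
  obtain es where es: "mset es = M2" using ex_mset by blast
  have "p = (\<Prod>x\<in>#M. [:- x, 1:])"
    using complex_poly_decompose_multiset[of p] p(2) by (simp add: M_def)
  also have "\<dots> = (\<Prod>e\<leftarrow>0 # lam # es. [:- e, 1:])"
    by (simp add: M1 M2 flip: es prod_mset_prod_list)
  finally show ?thesis using that lam(2) \<open>Re_lambda2 G = y\<close> by (simp add: p_def)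
qed

text \<open>
  A Schur decomposition with the diagonal \<open>0, \<lambda>\<^sub>2, \<dots>\<close> yields linearly independent \<open>u\<^sub>0\<close> and \<open>u\<^sub>1\<close> with
  \<open>L u\<^sub>0 = 0\<close> and \<open>L u\<^sub>1 = b u\<^sub>0 + \<lambda>\<^sub>2 u\<^sub>1\<close>. If \<open>\<lambda>\<^sub>2 \<noteq> 0\<close>, any eigenvector for \<open>\<lambda>\<^sub>2\<close> will do, since \<open>L\<close> annihilates
  the constant vectors. If \<open>\<lambda>\<^sub>2 = 0\<close>, either \<open>u\<^sub>0\<close> has two different entries, or \<open>u\<^sub>0\<close> is constant and
  nonzero. In the latter case the entries of \<open>L u\<^sub>1 = b u\<^sub>0\<close> sum to \<open>0\<close>, so \<open>b = 0\<close>, and \<open>u\<^sub>1\<close> is an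
  eigenvector that is not constant.
\<close>

lemma disagreement_eigenvector:
  assumes G: "weighted_digraph G" and N: "num_nodes G \<ge> 2"
    and normal: "normal_matrix (laplacian G)"
  obtains lam and v :: "complex vec" where "eigenvalue (complex_laplacian G) lam"
    and "Re lam = Re_lambda2 G"
    and "v \<in> carrier_vec (num_nodes G)" and "complex_laplacian G *\<^sub>v v = lam \<cdot>\<^sub>v v"
    and "\<exists>i<num_nodes G. \<exists>j<num_nodes G. v $ i \<noteq> v $ j"
proof -
  let ?A = "complex_laplacian G" and ?N = "num_nodes G"
  have A: "?A \<in> carrier_mat ?N ?N" by simp
  obtain lam es where cp: "char_poly ?A = (\<Prod>e\<leftarrow>0 # lam # es. [:- e, 1:])"
    and Re_lam: "Re lam = Re_lambda2 G"
    using char_poly_laplacian_factors[OF G N] .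
  have ev: "eigenvalue ?A lam"
    unfolding eigenvalue_root_char_poly[OF A] cp by simp
  obtain B P Q where "schur_decomposition ?A (0 # lam # es) = (B, P, Q)"
    by (metis prod_cases3)
  note schur = schur_decomposition[OF A cp this]
  note wit = similar_mat_witD2[OF A conjunct1[OF schur]]
  have B: "B \<in> carrier_mat ?N ?N" and P: "P \<in> carrier_mat ?N ?N" and Q: "Q \<in> carrier_mat ?N ?N"
    using wit by auto
  define u0 where "u0 = col P 0"
  define u1 where "u1 = col P 1"
  have u: "u0 \<in> carrier_vec ?N" "u1 \<in> carrier_vec ?N" using P by (auto simp: u0_def u1_def intro!: carrier_vecI)
  have AP: "?A * P = P * B"
  proof -
    have "?A * P = P * B * (Q * P)" using B P Q by (subst wit(3)) (simp add: assoc_mult_mat[of _ ?N ?N _ ?N _ ?N])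
    then show ?thesis using B P by (simp add: wit(2))
  qed
  have diag: "B $$ (0, 0) = 0" "B $$ (1, 1) = lam"
    using schur B N by (auto simp: diag_mat_def list_eq_iff_nth_eq nth_Cons split: nat.splits)
  have low: "B $$ (i, j) = 0" if "j < i" "i < ?N" for i j
    using schur B that by (auto simp: upper_triangular_def)
  define b where "b = B $$ (0, 1)"
  have A_col: "?A *\<^sub>v col P j = P *\<^sub>v col B j" if "j < ?N" for j
    using col_mult2[OF A P that] col_mult2[OF P B that] by (simp add: AP)
  have "col B 0 = 0\<^sub>v ?N"
  proof (rule eq_vecI)
    fix i assume "i < dim_vec (0\<^sub>v ?N)"
    then show "col B 0 $ i = 0\<^sub>v ?N $ i" using B diag low[of 0 i] by (cases "i = 0") auto
  qed (use B in auto)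
  then have Au0: "?A *\<^sub>v u0 = 0\<^sub>v ?N"
    using A_col[of 0] N P by (auto simp: u0_def)
  have "col B 1 = b \<cdot>\<^sub>v unit_vec ?N 0 + lam \<cdot>\<^sub>v unit_vec ?N 1"
  proof (rule eq_vecI)
    fix i assume "i < dim_vec (b \<cdot>\<^sub>v unit_vec ?N 0 + lam \<cdot>\<^sub>v unit_vec ?N 1)"
    then have "i < ?N" by simp
    then show "col B 1 $ i = (b \<cdot>\<^sub>v unit_vec ?N 0 + lam \<cdot>\<^sub>v unit_vec ?N 1) $ i"
      using B N diag low[of 1 i] by (cases "i = 0"; cases "i = 1") (auto simp: b_def)
  qed (use B in auto)
  moreover have "P *\<^sub>v unit_vec ?N j = col P j" if "j < ?N" for j
    using P that by (intro eq_vecI) auto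
  ultimately have Au1: "?A *\<^sub>v u1 = b \<cdot>\<^sub>v u0 + lam \<cdot>\<^sub>v u1"
    using A_col[of 1] N P
    by (auto simp: u0_def u1_def mult_add_distrib_mat_vec[of _ ?N ?N] mult_mat_vec[of _ ?N ?N])
  have QP_col: "Q *\<^sub>v col P j = unit_vec ?N j" if "j < ?N" for j
    using col_mult2[OF Q P that] that by (simp add: wit(2))
  have Qu: "Q *\<^sub>v u0 = unit_vec ?N 0" "Q *\<^sub>v u1 = unit_vec ?N 1"
    using QP_col N by (auto simp: u0_def u1_def)
  have non_parallel: False if "u0 = c \<cdot>\<^sub>v w" "u1 = d \<cdot>\<^sub>v w" "w \<in> carrier_vec ?N" for c d w
  proof -
    have "c \<cdot>\<^sub>v (Q *\<^sub>v w) = unit_vec ?N 0" "d \<cdot>\<^sub>v (Q *\<^sub>v w) = unit_vec ?N 1"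
      unfolding Qu[symmetric] that(1,2) mult_mat_vec[OF Q that(3)] by (rule refl)+
    then have "c * (Q *\<^sub>v w) $ 0 = 1" "d * (Q *\<^sub>v w) $ 0 = 0" "d * (Q *\<^sub>v w) $ 1 = 1"
      using N Q by (auto simp: vec_eq_iff)
    then show False by auto
  qed
  define e where "e = vec ?N (\<lambda>_. 1 :: complex)"
  have e: "e \<in> carrier_vec ?N" by (simp add: e_def)
  have const_vec: "v = v $ 0 \<cdot>\<^sub>v e"
    if "v \<in> carrier_vec ?N" "\<not> (\<exists>i<?N. \<exists>j<?N. v $ i \<noteq> v $ j)" for v :: "complex vec"
  proof (rule eq_vecI)
    fix i assume "i < dim_vec (v $ 0 \<cdot>\<^sub>v e)"
    then have "i < ?N" by (simp add: e_def)
    moreover have "0 < ?N" using N by simp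
    ultimately have "v $ i = v $ 0" using that(2) by blast
    with \<open>i < ?N\<close> show "v $ i = (v $ 0 \<cdot>\<^sub>v e) $ i" by (simp add: e_def)
  qed (use that in \<open>simp add: e_def\<close>)
  have Ae: "?A *\<^sub>v e = 0\<^sub>v ?N"
    unfolding e_def by (rule complex_laplacian_mult_ones[OF G])
  show ?thesis
  proof (cases "lam = 0")
    case False
    obtain v where v: "v \<in> carrier_vec ?N" "v \<noteq> 0\<^sub>v ?N" and Av: "?A *\<^sub>v v = lam \<cdot>\<^sub>v v"
      using ev by (auto simp: eigenvalue_def eigenvector_def complex_laplacian_def laplacian_def)
    have "\<exists>i<?N. \<exists>j<?N. v $ i \<noteq> v $ j"
    proof (rule ccontr)
      assume "\<not> ?thesis"
      with const_vec v obtain c where c: "v = c \<cdot>\<^sub>v e" by blast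
      have "lam \<cdot>\<^sub>v v = c \<cdot>\<^sub>v 0\<^sub>v ?N"
        using Av mult_mat_vec[OF A e, of c] Ae c by metis
      then show False using False v by (auto simp: vec_eq_iff)
    qed
    with that ev Re_lam v Av show ?thesis by blast
  next
    case True
    have "0 \<cdot>\<^sub>v u0 = 0\<^sub>v ?N" using u by auto
    show ?thesis
    proof (cases "\<exists>i<?N. \<exists>j<?N. u0 $ i \<noteq> u0 $ j")
      case True
      with that[OF ev Re_lam u(1)] Au0 u \<open>lam = 0\<close> \<open>0 \<cdot>\<^sub>v u0 = 0\<^sub>v ?N\<close> show ?thesis by simp
    next
      case False
      with const_vec u obtain c where c: "u0 = c \<cdot>\<^sub>v e" by blast
      have "(\<Sum>i<?N. (?A *\<^sub>v u1) $ i) =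
          (\<Sum>i<?N. \<Sum>j<?N. of_real (laplacian G $$ (i, j)) * u1 $ j)"
        using u(2) by (simp add: complex_laplacian_def laplacian_def scalar_prod_def lessThan_atLeast0)
      also have "\<dots> = (\<Sum>j<?N. of_real (\<Sum>i<?N. laplacian G $$ (i, j)) * u1 $ j)"
        by (subst sum.swap) (simp add: sum_distrib_right)
      also have "\<dots> = 0" using normal_laplacian_column_sum[OF G normal] by simp
      finally have "of_nat ?N * (b * c) = 0"
        using Au1 \<open>lam = 0\<close> u e by (simp add: c e_def)
      moreover have "0 \<cdot>\<^sub>v e = 0 \<cdot>\<^sub>v u1" using u e by (intro eq_vecI) auto
      then have "c \<noteq> 0"
        using non_parallel[of 0 u1 1] c u e by auto
      ultimately have "b = 0" using N by auto
      then have Au1': "?A *\<^sub>v u1 = 0 \<cdot>\<^sub>v u1"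
        using Au1 \<open>lam = 0\<close> u by auto
      have "\<exists>i<?N. \<exists>j<?N. u1 $ i \<noteq> u1 $ j"
        using const_vec u c non_parallel e by blast
      with that[OF ev Re_lam u(2)] Au1' \<open>lam = 0\<close> show ?thesis by simp
    qed
  qed
qed

section \<open>Modes of the closed loop\<close>

text \<open>
  The factor \<open>c\<close> shifts the phase of the real part. The choices \<open>1\<close> and \<open>- \<i>\<close> give the real and
  the imaginary part of the complex mode.
\<close>

lemma modal_trajectory:
  fixes v :: "complex vec" and c s lam :: complex
  assumes G: "weighted_digraph G" and n: "n \<ge> 1"
    and v: "v \<in> carrier_vec (num_nodes G)" and Lv: "complex_laplacian G *\<^sub>v v = lam \<cdot>\<^sub>v v"
    and root: "s ^ n + lam * (\<Sum>k<n. of_real (a k) * s ^ k) = 0"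
  shows "closed_loop_trajectory G n a (\<lambda>k i t. Re (c * s ^ k * exp (s * of_real t) * v $ i))"
    (is "closed_loop_trajectory G n a ?x")
proof -
  have deriv: "(?x k i has_real_derivative ?x (Suc k) i t) (at t within {0..})" for k i t
  proof -
    have "((\<lambda>z. c * s ^ k * exp (s * z) * v $ i) has_field_derivative
        c * s ^ Suc k * exp (s * of_real t) * v $ i) (at (of_real t))"
      by (auto intro!: derivative_eq_intros)
    then have "((\<lambda>t. c * s ^ k * exp (s * of_real t) * v $ i) has_vector_derivative
        c * s ^ Suc k * exp (s * of_real t) * v $ i) (at t within {0..})"
      by (rule has_vector_derivative_real_field)
    then show ?thesis by (rule has_field_derivative_Re)
  qed
  have control: "consensus_control G n a (\<lambda>k j. ?x k j t) i = ?x n i t" if i: "i < num_nodes G" for i t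
  proof -
    have eigen: "(\<Sum>j\<in>neighbors G i. complex_of_real (weight G i j) * (v $ i - v $ j)) = lam * v $ i"
      using complex_laplacian_mult_vec[OF G v i] Lv v i by simp
    have "consensus_control G n a (\<lambda>k j. ?x k j t) i =
        Re (- (\<Sum>k<n. of_real (a k) * (\<Sum>j\<in>neighbors G i. of_real (weight G i j) *
          (c * s ^ k * exp (s * of_real t) * v $ i - c * s ^ k * exp (s * of_real t) * v $ j))))"
      by (simp add: consensus_control_def)
    also have "(\<Sum>k<n. of_real (a k) * (\<Sum>j\<in>neighbors G i. of_real (weight G i j) *
          (c * s ^ k * exp (s * of_real t) * v $ i - c * s ^ k * exp (s * of_real t) * v $ j))) =
        (\<Sum>k<n. of_real (a k) * s ^ k * (c * exp (s * of_real t) *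
          (\<Sum>j\<in>neighbors G i. of_real (weight G i j) * (v $ i - v $ j))))"
      by (intro sum.cong refl) (simp add: sum_distrib_left algebra_simps)
    also have "\<dots> = c * exp (s * of_real t) * v $ i * (lam * (\<Sum>k<n. of_real (a k) * s ^ k))"
      unfolding eigen by (simp add: sum_distrib_left mult_ac)
    also have "lam * (\<Sum>k<n. of_real (a k) * s ^ k) = - (s ^ n)"
      using root by (simp add: eq_neg_iff_add_eq_0 add.commute)
    finally show ?thesis by (simp add: mult_ac)
  qed
  have "Suc (n - 1) = n" using n by simp
  show ?thesis
    unfolding closed_loop_trajectory_def
  proof (intro allI impI conjI)
    fix i t k
    show "(?x k i has_real_derivative ?x (Suc k) i t) (at t within {0..})" by (rule deriv)
  next
    fix i t assume i: "i < num_nodes G"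
    show "(?x (n - 1) i has_real_derivative consensus_control G n a (\<lambda>k j. ?x k j t) i)
        (at t within {0..})"
      using deriv[of "n - 1" i t] unfolding control[OF i] \<open>Suc (n - 1) = n\<close> .
  qed
qed

lemma unstable_mode_prevents_consensus:
  fixes v :: "complex vec" and s lam :: complex
  assumes G: "weighted_digraph G" and n: "n \<ge> 1"
    and v: "v \<in> carrier_vec (num_nodes G)" and Lv: "complex_laplacian G *\<^sub>v v = lam \<cdot>\<^sub>v v"
    and ij: "i < num_nodes G" "j < num_nodes G" "v $ i \<noteq> v $ j"
    and root: "s ^ n + lam * (\<Sum>k<n. of_real (a k) * s ^ k) = 0" and s: "0 \<le> Re s"
  shows "\<not> reaches_consensus G n a"
proof
  assume consensus: "reaches_consensus G n a"
  have lim: "((\<lambda>t. Re (c * exp (s * of_real t) * (v $ i - v $ j))) \<longlongrightarrow> 0) at_top" for c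
  proof -
    have "((\<lambda>t. Re (c * s ^ 0 * exp (s * of_real t) * v $ i) -
        Re (c * s ^ 0 * exp (s * of_real t) * v $ j)) \<longlongrightarrow> 0) at_top"
      using n by (intro consensus[unfolded reaches_consensus_def, rule_format,
          OF modal_trajectory[OF G n v Lv root, of c] ij(1,2)]) simp
    also have "(\<lambda>t. Re (c * s ^ 0 * exp (s * of_real t) * v $ i) -
        Re (c * s ^ 0 * exp (s * of_real t) * v $ j)) =
        (\<lambda>t. Re (c * exp (s * of_real t) * (v $ i - v $ j)))"
      by (simp only: minus_complex.sel(1)[symmetric] right_diff_distrib power_0 mult_1_right)
    finally show ?thesis .
  qed
  have "((\<lambda>t. exp (s * of_real t) * (v $ i - v $ j)) \<longlongrightarrow> 0) at_top"
    unfolding tendsto_complex_iff using lim[of 1] lim[of "- \<i>"] by (simp add: algebra_simps)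
  then have "((\<lambda>t. cmod (exp (s * of_real t) * (v $ i - v $ j))) \<longlongrightarrow> 0) at_top"
    by (rule tendsto_norm_zero)
  moreover have "\<forall>\<^sub>F t in at_top. cmod (v $ i - v $ j) \<le> cmod (exp (s * of_real t) * (v $ i - v $ j))"
    using eventually_ge_at_top[of 0]
    by eventually_elim (use s in \<open>simp add: norm_mult mult_le_cancel_right1\<close>)
  ultimately have "cmod (v $ i - v $ j) \<le> 0"
    by (rule tendsto_lowerbound) simp
  then show False using ij(3) by simp
qed

section \<open>Failure of consensus in large networks\<close>

theorem theorem3:
  fixes n q :: nat
    and w_max a_max :: real
    and sizes :: "nat set"
    and G :: "nat \<Rightarrow> network"
  assumes "n \<ge> 3"
    and "q > 0"
    and "w_max > 0"
    and "a_max > 0"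
    and "infinite sizes"
    and "\<forall>N\<in>sizes. N \<ge> 2"
    and "\<forall>N\<in>sizes. num_nodes (G N) = N"
    and "\<forall>N\<in>sizes. weighted_digraph (G N)"
    and "\<forall>N\<in>sizes. has_spanning_tree (G N)"
    and "\<forall>N\<in>sizes. normal_matrix (laplacian (G N))"
    and "\<forall>N\<in>sizes. \<forall>i<N. card (neighbors (G N) i) \<le> q"
    and "\<forall>N\<in>sizes. \<forall>(i, j)\<in>edges (G N). weight (G N) i j \<le> w_max"
    and "((\<lambda>N. Re_lambda2 (G N)) \<longlongrightarrow> 0) (inf sequentially (principal sizes))"
  shows "\<not> (\<exists>a :: nat \<Rightarrow> real. (\<forall>k<n. 0 \<le> a k \<and> a k \<le> a_max) \<and> admissible sizes G n a)"
proof (rule notI, elim exE conjE)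
  fix a :: "nat \<Rightarrow> real"
  assume adm: "admissible sizes G n a"
  \<comment> \<open>An upper bound, uniform in the network size, for the diagonal entries of the Laplacians.\<close>
  define D where "D = real q * w_max"
  \<comment> \<open>The smallness condition of \<open>closed_right_half_plane_root\<close> is \<open>K |\<lambda>|\<^sup>2 < 1\<close>.\<close>
  define K where "K = ((a 1 / a 0)\<^sup>2 + 2 * (a 2 / a 0)) ^ n * (a 0)\<^sup>2"
  have "((\<lambda>N. K * (2 * D * Re_lambda2 (G N))) \<longlongrightarrow> K * (2 * D * 0)) (inf sequentially (principal sizes))"
    by (intro tendsto_intros assms(13))
  then have "\<forall>\<^sub>F N in inf sequentially (principal sizes). K * (2 * D * Re_lambda2 (G N)) < 1"
    by (rule order_tendstoD(2)) simp
  then obtain N0 where N0: "\<And>N. N \<ge> N0 \<Longrightarrow> N \<in> sizes \<Longrightarrow> K * (2 * D * Re_lambda2 (G N)) < 1"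
    by (auto simp: eventually_inf_principal eventually_sequentially)
  obtain N where N: "N \<in> sizes" "N \<ge> N0"
    using assms(5) by (meson infinite_nat_iff_unbounded_le)
  have nodes: "num_nodes (G N) = N" and G: "weighted_digraph (G N)"
    using assms(7,8) N by auto
  obtain lam and v :: "complex vec" where
    ev: "eigenvalue (complex_laplacian (G N)) lam" and Re_lam: "Re lam = Re_lambda2 (G N)"
    and v: "v \<in> carrier_vec (num_nodes (G N))" "complex_laplacian (G N) *\<^sub>v v = lam \<cdot>\<^sub>v v"
    and "\<exists>i<num_nodes (G N). \<exists>j<num_nodes (G N). v $ i \<noteq> v $ j"
    using disagreement_eigenvector[OF G] assms(6,10) N nodes by metis
  then obtain i j where ij: "i < num_nodes (G N)" "j < num_nodes (G N)" "v $ i \<noteq> v $ j" by auto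
  obtain m where m: "m < N"
    and disc: "(cmod lam)\<^sup>2 \<le> 2 * (\<Sum>k\<in>neighbors (G N) m. weight (G N) m k) * Re lam"
    using gershgorin_disc_at_origin(1)[OF G ev] nodes by auto
  have "(\<Sum>k\<in>neighbors (G N) m. weight (G N) m k) \<le> real (card (neighbors (G N) m)) * w_max"
    using assms(12) N(1) by (intro sum_bounded_above) (auto simp: neighbors_def)
  also have "\<dots> \<le> D"
    using assms(3,11) N(1) m by (auto simp: D_def intro!: mult_right_mono)
  finally have "2 * (\<Sum>k\<in>neighbors (G N) m. weight (G N) m k) * Re lam \<le> 2 * D * Re lam"
    using gershgorin_disc_at_origin(2)[OF G ev] by (intro mult_right_mono) auto
  with disc have lam_le: "(cmod lam)\<^sup>2 \<le> 2 * D * Re lam" by simp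
  have "K * (cmod lam)\<^sup>2 < 1"
  proof (cases "K \<ge> 0")
    case True
    then have "K * (cmod lam)\<^sup>2 \<le> K * (2 * D * Re lam)" by (rule mult_left_mono[OF lam_le])
    with N0[OF N(2,1)] Re_lam show ?thesis by simp
  next
    case False
    then have "K * (cmod lam)\<^sup>2 \<le> 0" by (simp add: mult_nonpos_nonneg)
    then show ?thesis by simp
  qed
  then obtain s where "Re s \<ge> 0" "s ^ n + lam * (\<Sum>k<n. of_real (a k) * s ^ k) = 0"
    using closed_right_half_plane_root[OF assms(1), of a lam]
    by (auto simp: K_def power_mult_distrib mult_ac)
  then have "\<not> reaches_consensus (G N) n a"
    using unstable_mode_prevents_consensus[OF G _ v ij] assms(1) by simp
  with adm N(1) show False by (auto simp: admissible_def)
qed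

end
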